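(* Let $(\Omega,\Sigma,\mu)$ and $(\Omega,\Sigma,\nu)$ be two $\sigma$-finite measure spaces, let $p,q\in[1,+\infty]$, and let $g\in L_0(\Omega,\mu)$ be such that the multiplication operator $M_g:L_p(\Omega,\mu)\to L_q(\Omega,\nu)$, $f\mapsto g\cdot f$, is a well-defined bounded operator. Let $\Omega=\Omega_c\sqcup\Omega_s$ be the partition from the Lebesgue decomposition of $\mu$ with respect to $\nu$. Then the following are equivalent: i) $M_g\in\mathcal{B}(L_p(\Omega,\mu),L_q(\Omega,\nu))$ is topologically surjective; ii) $M_{\chi_{\Omega_c}/g}$ is a well-defined bounded operator in $\mathcal{B}(L_q(\Omega,\nu),L_p(\Omega,\mu))$, it is a right inverse of $M_g$ (that is, $M_gM_{\chi_{\Omega_c}/g}=1_{L_q(\Omega,\nu)}$), and it is topologically injective.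
   Context: All linear spaces are over $\mathbb{C}$; measures are nonnegative, $\sigma$-additive, with values in $[0,+\infty]$. $L_0(\Omega,\mu)$ is the space of measurable complex functions on $\Omega$. Lebesgue decomposition of $\mu$ with respect to $\nu$: a nonnegative measurable function $\rho_{\mu,\nu}$, a $\sigma$-finite measure $\mu_s$ and a set $\Omega_s\in\Sigma$ such that $\mu=\rho_{\mu,\nu}\cdot\nu+\mu_s$ and $\nu(\Omega_s)=\mu_s(\Omega_c)=0$, where $\Omega_c=\Omega\setminus\Omega_s$ and $(\rho\cdot\nu)(E)=\int_E\rho\,d\nu$. $M_h$ denotes multiplication by the measurable function $h$. $\chi_{\Omega_c}$ is the indicator function of $\Omega_c$; $\chi_{\Omega_c}/g$ is the function equal to $1/g$ on $\Omega_c$ and $0$ elsewhere (with value $0$ also at points where $g=0$). A bounded operator $T:X\to Y$ between normed spaces is topologically injective if there is $c>0$ with $\|T(x)\|\geq c\|x\|$ for all $x\in X$; it is topologically surjective if there is $c>0$ such that for every $y\in Y$ there is $x\in X$ with $T(x)=y$ and $\|x\|\leq c\|y\|$. *)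

theory Defs
  imports "HOL-Probability.Essential_Supremum"
begin

section \<open>Bounded operators on complex normed spaces\<close>

text \<open>Normed spaces are given by explicit carriers, because the spaces \<open>L\<^sub>p(\<Omega>,\<mu>)\<close> depend on
  the measure and on the exponent and hence are not types.\<close>

record 'v cnormed =
  carrier :: "'v set"
  add :: "'v \<Rightarrow> 'v \<Rightarrow> 'v"
  scale :: "complex \<Rightarrow> 'v \<Rightarrow> 'v"
  norm_of :: "'v \<Rightarrow> real"

definition bounded_operator :: "'v cnormed \<Rightarrow> 'w cnormed \<Rightarrow> ('v \<Rightarrow> 'w) \<Rightarrow> bool" where
  "bounded_operator X Y T \<longleftrightarrow>
     (\<forall>x\<in>carrier X. T x \<in> carrier Y) \<and>
     (\<forall>x\<in>carrier X. \<forall>y\<in>carrier X. T (add X x y) = add Y (T x) (T y)) \<and>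
     (\<forall>c. \<forall>x\<in>carrier X. T (scale X c x) = scale Y c (T x)) \<and>
     (\<exists>C. \<forall>x\<in>carrier X. norm_of Y (T x) \<le> C * norm_of X x)"

definition topologically_injective :: "'v cnormed \<Rightarrow> 'w cnormed \<Rightarrow> ('v \<Rightarrow> 'w) \<Rightarrow> bool" where
  "topologically_injective X Y T \<longleftrightarrow>
     (\<exists>c>0. \<forall>x\<in>carrier X. norm_of Y (T x) \<ge> c * norm_of X x)"

definition topologically_surjective :: "'v cnormed \<Rightarrow> 'w cnormed \<Rightarrow> ('v \<Rightarrow> 'w) \<Rightarrow> bool" where
  "topologically_surjective X Y T \<longleftrightarrow>
     (\<exists>c>0. \<forall>y\<in>carrier Y. \<exists>x\<in>carrier X. T x = y \<and> norm_of X x \<le> c * norm_of Y y)"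


section \<open>The spaces \<open>L\<^sub>p(\<Omega>,\<mu>)\<close>\<close>

text \<open>The essential supremum is taken in \<^typ>\<open>ennreal\<close>, so that it is \<open>0\<close> for the zero measure.\<close>

definition Lp_functions :: "ennreal \<Rightarrow> 'a measure \<Rightarrow> ('a \<Rightarrow> complex) set" where
  "Lp_functions p M = {f \<in> borel_measurable M.
     if p = \<infinity> then esssup M (\<lambda>x. ennreal (cmod (f x))) < \<infinity>
     else integrable M (\<lambda>x. cmod (f x) powr enn2real p)}"

definition Lp_seminorm :: "ennreal \<Rightarrow> 'a measure \<Rightarrow> ('a \<Rightarrow> complex) \<Rightarrow> real" where
  "Lp_seminorm p M f =
     (if p = \<infinity> then enn2real (esssup M (\<lambda>x. ennreal (cmod (f x))))
      else (\<integral>x. cmod (f x) powr enn2real p \<partial>M) powr (1 / enn2real p))"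

definition ae_class :: "'a measure \<Rightarrow> ('a \<Rightarrow> complex) \<Rightarrow> ('a \<Rightarrow> complex) set" where
  "ae_class M f = {f' \<in> borel_measurable M. AE x in M. f' x = f x}"

text \<open>The elements of \<open>L\<^sub>p\<close> are the classes of almost everywhere equal functions. The seminorm is
  constant on a class, so that its image is a singleton.\<close>

definition Lp :: "ennreal \<Rightarrow> 'a measure \<Rightarrow> ('a \<Rightarrow> complex) set cnormed" where
  "Lp p M = \<lparr>
     carrier = ae_class M ` Lp_functions p M,
     add = (\<lambda>A B. \<Union>f\<in>A. \<Union>g\<in>B. ae_class M (\<lambda>x. f x + g x)),
     scale = (\<lambda>c A. \<Union>f\<in>A. ae_class M (\<lambda>x. c * f x)),
     norm_of = (\<lambda>A. the_elem (Lp_seminorm p M ` A)) \<rparr>"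


section \<open>Multiplication operators\<close>

text \<open>As the two measures need not be related, multiplication by \<open>h\<close> need not respect almost
  everywhere equality; this is part of being well defined. If it holds, \<open>mult_op N h\<close> maps
  the class of \<open>f\<close> to the class of \<open>h * f\<close> with respect to the target measure \<open>N\<close>.\<close>

definition mult_well_defined ::
    "ennreal \<Rightarrow> 'a measure \<Rightarrow> ennreal \<Rightarrow> 'a measure \<Rightarrow> ('a \<Rightarrow> complex) \<Rightarrow> bool" where
  "mult_well_defined p M q N h \<longleftrightarrow>
     (\<forall>f\<in>Lp_functions p M. (\<lambda>x. h x * f x) \<in> Lp_functions q N) \<and>
     (\<forall>f\<in>Lp_functions p M. \<forall>f'\<in>Lp_functions p M.
        (AE x in M. f x = f' x) \<longrightarrow> (AE x in N. h x * f x = h x * f' x))"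

definition mult_op :: "'a measure \<Rightarrow> ('a \<Rightarrow> complex) \<Rightarrow> ('a \<Rightarrow> complex) set \<Rightarrow> ('a \<Rightarrow> complex) set" where
  "mult_op N h A = (\<Union>f\<in>A. ae_class N (\<lambda>x. h x * f x))"


section \<open>Lebesgue decomposition\<close>

text \<open>The decomposition \<open>M = \<rho> \<cdot> N + M\<^sub>s\<close>, where \<open>M\<^sub>s\<close> is concentrated on the \<open>N\<close>-null set \<open>S\<close>.\<close>

definition lebesgue_decomposition ::
    "'a measure \<Rightarrow> 'a measure \<Rightarrow> ('a \<Rightarrow> real) \<Rightarrow> 'a measure \<Rightarrow> 'a set \<Rightarrow> bool" where
  "lebesgue_decomposition M N \<rho> M\<^sub>s S \<longleftrightarrow>
     \<rho> \<in> borel_measurable N \<and> (\<forall>x\<in>space N. 0 \<le> \<rho> x) \<and>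
     sets M\<^sub>s = sets M \<and> sigma_finite_measure M\<^sub>s \<and>
     (\<forall>E\<in>sets M. emeasure M E = emeasure (density N (\<lambda>x. ennreal (\<rho> x))) E + emeasure M\<^sub>s E) \<and>
     S \<in> sets M \<and> emeasure N S = 0 \<and> emeasure M\<^sub>s (space M - S) = 0"

end

theory Submission
  imports Defs
begin

text \<open>Write \<open>h = \<chi>\<^sub>c / g\<close>, where \<open>\<chi>\<^sub>c\<close> is the indicator of \<open>\<Omega>\<^sub>c\<close>.

  Surjectivity forces \<open>g\<close> to be nonzero \<open>\<nu>\<close>-almost everywhere, because \<open>L\<^sub>q(\<nu>)\<close> of a
  \<open>\<sigma>\<close>-finite measure contains a function without zeros, and this function is a multiple of \<open>g\<close>
  (\<open>Lp_nonvanishing_function\<close>, \<open>surjective_imp_multiplier_nonzero\<close>). As multiplication by \<open>g\<close>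
  respects almost everywhere equality, applying it to the indicator of a \<open>\<mu>\<close>-null set then shows
  that this set is also \<open>\<nu>\<close>-null (\<open>multiplier_nonzero_imp_AE_transfer\<close>). In the other direction,
  the Lebesgue decomposition makes every \<open>\<nu>\<close>-null set \<open>\<mu>\<close>-null inside \<open>\<Omega>\<^sub>c\<close>
  (\<open>lebesgue_decomposition_AE_transfer\<close>). Hence the two measures have the same null sets
  on \<open>\<Omega>\<^sub>c\<close>, and \<open>\<Omega>\<^sub>s\<close> is \<open>\<nu>\<close>-null.

  Now let \<open>f\<close> be in \<open>L\<^sub>q(\<nu>)\<close> and let \<open>u\<close> in \<open>L\<^sub>p(\<mu>)\<close> be a preimage of \<open>f\<close> with
  \<open>\<parallel>u\<parallel> \<le> c \<parallel>f\<parallel>\<close>. The equation \<open>g u = f\<close> can be solved for \<open>u\<close> on \<open>\<Omega>\<^sub>c\<close>, so \<open>h f = \<chi>\<^sub>c u\<close>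
  holds \<open>\<mu>\<close>-almost everywhere. Thus \<open>h f\<close> is in \<open>L\<^sub>p(\<mu>)\<close> with \<open>\<parallel>h f\<parallel> \<le> \<parallel>u\<parallel> \<le> c \<parallel>f\<parallel>\<close>, and
  \<open>g h f = f\<close>. The exponents enter here only through the monotonicity of the norms in the
  absolute value (\<open>Lp_functions_dominated\<close>, \<open>Lp_seminorm_mono\<close>). Finally, a right inverse of a
  bounded operator is bounded below (\<open>right_inverse_topologically_injective\<close>), and an operator
  with a bounded right inverse is topologically surjective
  (\<open>bounded_right_inverse_topologically_surjective\<close>).\<close>

section \<open>Right inverses of bounded operators\<close>

text \<open>If \<open>T R = 1\<close>, then \<open>\<parallel>y\<parallel> = \<parallel>T (R y)\<parallel> \<le> C \<parallel>R y\<parallel>\<close>. Norms of \<^typ>\<open>'v cnormed\<close> are arbitrary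
  real functions, so their nonnegativity is a hypothesis; it allows the constant \<open>C\<close> to be
  replaced by a positive one.\<close>

lemma right_inverse_topologically_injective:
  assumes T: "bounded_operator X Y T"
    and R: "\<And>y. y \<in> carrier Y \<Longrightarrow> R y \<in> carrier X"
    and TR: "\<And>y. y \<in> carrier Y \<Longrightarrow> T (R y) = y"
    and nonneg: "\<And>x. x \<in> carrier X \<Longrightarrow> 0 \<le> norm_of X x"
  shows "topologically_injective Y X R"
proof -
  obtain C where C: "\<And>x. x \<in> carrier X \<Longrightarrow> norm_of Y (T x) \<le> C * norm_of X x"
    using T unfolding bounded_operator_def by blast
  have "(1 / max C 1) * norm_of Y y \<le> norm_of X (R y)" if y: "y \<in> carrier Y" for y
  proof -
    have "norm_of Y y \<le> C * norm_of X (R y)"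
      using C[OF R[OF y]] TR[OF y] by simp
    also have "\<dots> \<le> max C 1 * norm_of X (R y)"
      using nonneg[OF R[OF y]] by (intro mult_right_mono) auto
    finally show ?thesis by (simp add: field_simps)
  qed
  then show ?thesis
    unfolding topologically_injective_def by (intro exI[of _ "1 / max C 1"]) auto
qed

lemma bounded_right_inverse_topologically_surjective:
  assumes R: "bounded_operator Y X R"
    and TR: "\<And>y. y \<in> carrier Y \<Longrightarrow> T (R y) = y"
    and nonneg: "\<And>y. y \<in> carrier Y \<Longrightarrow> 0 \<le> norm_of Y y"
  shows "topologically_surjective X Y T"
proof -
  obtain C where C: "\<And>y. y \<in> carrier Y \<Longrightarrow> norm_of X (R y) \<le> C * norm_of Y y"
    and Rc: "\<And>y. y \<in> carrier Y \<Longrightarrow> R y \<in> carrier X"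
    using R unfolding bounded_operator_def by blast
  have "norm_of X (R y) \<le> max C 1 * norm_of Y y" if y: "y \<in> carrier Y" for y
  proof -
    have "C * norm_of Y y \<le> max C 1 * norm_of Y y"
      using nonneg[OF y] by (intro mult_right_mono) auto
    then show ?thesis using C[OF y] by linarith
  qed
  then have "\<exists>x\<in>carrier X. T x = y \<and> norm_of X x \<le> max C 1 * norm_of Y y"
    if "y \<in> carrier Y" for y
    using that Rc TR by blast
  then show ?thesis
    unfolding topologically_surjective_def by (intro exI[of _ "max C 1"]) simp
qed

section \<open>Functions and classes in \<open>L\<^sub>p\<close>\<close>

lemma Lp_functions_measurable: "f \<in> Lp_functions p M \<Longrightarrow> f \<in> borel_measurable M"
  by (simp add: Lp_functions_def)

lemma Lp_functions_dominated:
  assumes u: "u \<in> Lp_functions p M" and f[measurable]: "f \<in> borel_measurable M"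
    and le: "AE x in M. cmod (f x) \<le> cmod (u x)"
  shows "f \<in> Lp_functions p M"
proof (cases "p = \<infinity>")
  case True
  have "AE x in M. ennreal (cmod (f x)) \<le> ennreal (cmod (u x))"
    using le by eventually_elim (rule ennreal_leI)
  then have "esssup M (\<lambda>x. ennreal (cmod (f x))) \<le> esssup M (\<lambda>x. ennreal (cmod (u x)))"
    using f by (intro esssup_AE_mono) auto
  then show ?thesis using u True f by (auto simp: Lp_functions_def)
next
  case False
  have "integrable M (\<lambda>x. cmod (f x) powr enn2real p)"
  proof (rule Bochner_Integration.integrable_bound)
    show "integrable M (\<lambda>x. cmod (u x) powr enn2real p)"
      using u False by (simp add: Lp_functions_def)
    show "AE x in M. norm (cmod (f x) powr enn2real p) \<le> norm (cmod (u x) powr enn2real p)"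
      using le by eventually_elim (auto intro!: powr_mono2)
  qed measurable
  then show ?thesis using False f by (auto simp: Lp_functions_def)
qed

lemma Lp_seminorm_mono:
  assumes u: "u \<in> Lp_functions p M" and f: "f \<in> borel_measurable M"
    and le: "AE x in M. cmod (f x) \<le> cmod (u x)"
  shows "Lp_seminorm p M f \<le> Lp_seminorm p M u"
proof (cases "p = \<infinity>")
  case True
  have "AE x in M. ennreal (cmod (f x)) \<le> ennreal (cmod (u x))"
    using le by eventually_elim (rule ennreal_leI)
  then have "esssup M (\<lambda>x. ennreal (cmod (f x))) \<le> esssup M (\<lambda>x. ennreal (cmod (u x)))"
    using f by (intro esssup_AE_mono) auto
  then show ?thesis using u True by (auto simp: Lp_functions_def Lp_seminorm_def intro!: enn2real_mono)
next
  case False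
  have "(\<integral>x. cmod (f x) powr enn2real p \<partial>M) \<le> (\<integral>x. cmod (u x) powr enn2real p \<partial>M)"
  proof (rule integral_mono_AE)
    show "integrable M (\<lambda>x. cmod (u x) powr enn2real p)"
      using u False by (simp add: Lp_functions_def)
    show "integrable M (\<lambda>x. cmod (f x) powr enn2real p)"
      using Lp_functions_dominated[OF u f le] False by (simp add: Lp_functions_def)
    show "AE x in M. cmod (f x) powr enn2real p \<le> cmod (u x) powr enn2real p"
      using le by eventually_elim (auto intro!: powr_mono2)
  qed
  then show ?thesis
    using False by (auto simp: Lp_seminorm_def intro!: powr_mono2)
qed

lemma Lp_functions_AE_cong:
  assumes "u \<in> Lp_functions p M" "f \<in> borel_measurable M" "AE x in M. f x = u x"
  shows "f \<in> Lp_functions p M"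
  using assms(3) by (intro Lp_functions_dominated[OF assms(1,2)]) auto

lemma Lp_seminorm_AE_cong:
  assumes u: "u \<in> Lp_functions p M" and f: "f \<in> borel_measurable M" and eq: "AE x in M. f x = u x"
  shows "Lp_seminorm p M f = Lp_seminorm p M u"
proof (rule antisym)
  show "Lp_seminorm p M f \<le> Lp_seminorm p M u"
    using eq by (intro Lp_seminorm_mono[OF u f]) auto
  show "Lp_seminorm p M u \<le> Lp_seminorm p M f"
    using eq
    by (intro Lp_seminorm_mono[OF Lp_functions_AE_cong[OF u f eq] Lp_functions_measurable[OF u]]) auto
qed

lemma Lp_seminorm_nonneg: "0 \<le> Lp_seminorm p M f"
  by (simp add: Lp_seminorm_def)

lemma ae_class_self: "f \<in> borel_measurable M \<Longrightarrow> f \<in> ae_class M f"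
  by (simp add: ae_class_def)

lemma ae_class_cong:
  assumes "AE x in M. f x = g x"
  shows "ae_class M f = ae_class M g"
proof -
  have "(AE x in M. u x = f x) \<longleftrightarrow> (AE x in M. u x = g x)" for u :: "'a \<Rightarrow> complex"
    using assms by (intro eventually_cong) (auto elim: eventually_mono)
  then show ?thesis by (simp add: ae_class_def)
qed

lemma carrier_LpI: "f \<in> Lp_functions p M \<Longrightarrow> ae_class M f \<in> carrier (Lp p M)"
  by (simp add: Lp_def)

lemma carrier_LpE:
  assumes "A \<in> carrier (Lp p M)"
  obtains f where "f \<in> Lp_functions p M" "A = ae_class M f"
  using assms by (auto simp: Lp_def)

lemma carrier_Lp_representative:
  assumes "A \<in> carrier (Lp p M)" "f \<in> A"
  shows "f \<in> Lp_functions p M" "A = ae_class M f"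
proof -
  obtain u where u: "u \<in> Lp_functions p M" "A = ae_class M u"
    using assms(1) by (rule carrier_LpE)
  with assms(2) have f: "f \<in> borel_measurable M" "AE x in M. f x = u x"
    by (auto simp: ae_class_def)
  show "f \<in> Lp_functions p M" by (rule Lp_functions_AE_cong[OF u(1) f])
  show "A = ae_class M f" unfolding u(2) by (rule ae_class_cong[OF f(2), symmetric])
qed

lemma norm_of_Lp_ae_class:
  assumes "f \<in> Lp_functions p M"
  shows "norm_of (Lp p M) (ae_class M f) = Lp_seminorm p M f"
proof -
  have "Lp_seminorm p M f' = Lp_seminorm p M f" if "f' \<in> ae_class M f" for f'
    using that by (intro Lp_seminorm_AE_cong[OF assms]) (auto simp: ae_class_def)
  then have "Lp_seminorm p M ` ae_class M f = {Lp_seminorm p M f}"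
    using ae_class_self[OF Lp_functions_measurable[OF assms]] by blast
  then show ?thesis by (simp add: Lp_def)
qed

lemma norm_of_Lp_nonneg: "A \<in> carrier (Lp p M) \<Longrightarrow> 0 \<le> norm_of (Lp p M) A"
  by (metis carrier_LpE norm_of_Lp_ae_class Lp_seminorm_nonneg)

lemma add_Lp_ae_class:
  assumes "f \<in> borel_measurable M" "g \<in> borel_measurable M"
  shows "add (Lp p M) (ae_class M f) (ae_class M g) = ae_class M (\<lambda>x. f x + g x)"
proof -
  have "ae_class M (\<lambda>x. f' x + g' x) = ae_class M (\<lambda>x. f x + g x)"
    if "f' \<in> ae_class M f" "g' \<in> ae_class M g" for f' g'
  proof (rule ae_class_cong)
    have "AE x in M. f' x = f x" "AE x in M. g' x = g x"
      using that by (auto simp: ae_class_def)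
    then show "AE x in M. f' x + g' x = f x + g x" by eventually_elim simp
  qed
  then have "(\<Union>f'\<in>ae_class M f. \<Union>g'\<in>ae_class M g. ae_class M (\<lambda>x. f' x + g' x))
      = ae_class M (\<lambda>x. f x + g x)"
    using ae_class_self[OF assms(1)] ae_class_self[OF assms(2)] by blast
  then show ?thesis by (simp add: Lp_def)
qed

lemma scale_Lp_ae_class:
  assumes "f \<in> borel_measurable M"
  shows "scale (Lp p M) c (ae_class M f) = ae_class M (\<lambda>x. c * f x)"
proof -
  have "ae_class M (\<lambda>x. c * f' x) = ae_class M (\<lambda>x. c * f x)" if "f' \<in> ae_class M f" for f'
  proof (rule ae_class_cong)
    have "AE x in M. f' x = f x"
      using that by (auto simp: ae_class_def)
    then show "AE x in M. c * f' x = c * f x" by eventually_elim simp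
  qed
  then have "(\<Union>f'\<in>ae_class M f. ae_class M (\<lambda>x. c * f' x)) = ae_class M (\<lambda>x. c * f x)"
    using ae_class_self[OF assms] by blast
  then show ?thesis by (simp add: Lp_def)
qed

text \<open>By \<open>\<sigma>\<close>-finiteness there is a strictly positive integrable function; for a finite exponent,
  its \<open>p\<close>-th root serves.\<close>

lemma Lp_nonvanishing_function:
  assumes "sigma_finite_measure M" "1 \<le> p"
  obtains y where "y \<in> Lp_functions p M" "\<forall>x. y x \<noteq> 0"
proof (cases "p = \<infinity>")
  case True
  have "esssup M (\<lambda>x. 1::ennreal) \<le> 1"
    by (intro esssup_I) auto
  then have "esssup M (\<lambda>x. 1::ennreal) < \<infinity>"
    by (rule le_less_trans) simp
  then have "(\<lambda>x. 1) \<in> Lp_functions p M"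
    using True by (simp add: Lp_functions_def)
  then show ?thesis by (intro that[of "\<lambda>x. 1"]) auto
next
  case False
  interpret sigma_finite_measure M by fact
  obtain w :: "'a \<Rightarrow> real" where w[measurable]: "w \<in> borel_measurable M"
    and pos: "\<And>x. w x > 0" and int: "integrable M w"
    using obtain_positive_integrable_function by metis
  define r where "r = enn2real p"
  have "r > 0"
    using assms(2) False unfolding r_def
    by (metis enn2real_positive_iff less_le_trans top.not_eq_extremum zero_less_one infinity_ennreal_def)
  define y where "y x = complex_of_real (w x powr (1 / r))" for x
  have ym: "y \<in> borel_measurable M" unfolding y_def by measurable
  have "(\<lambda>x. cmod (y x) powr r) = w"
    using pos \<open>r > 0\<close> by (auto simp: y_def powr_powr less_imp_le)
  then have "y \<in> Lp_functions p M"
    using ym False int by (simp add: Lp_functions_def r_def[symmetric])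
  moreover have "y x \<noteq> 0" for x
    using pos[of x] by (simp add: y_def)
  ultimately show ?thesis using that by blast
qed

section \<open>Multiplication operators\<close>

text \<open>That \<open>M\<close>-null sets are \<open>N\<close>-null where \<open>h \<noteq> 0\<close> makes all representatives of a class of \<open>M\<close> contribute
  the same class of \<open>N\<close> to the union in \<^const>\<open>mult_op\<close>.\<close>

lemma mult_op_ae_class:
  assumes "f \<in> borel_measurable M"
    and transfer: "\<And>P. AE x in M. P x \<Longrightarrow> AE x in N. h x \<noteq> 0 \<longrightarrow> P x"
  shows "mult_op N h (ae_class M f) = ae_class N (\<lambda>x. h x * f x)"
proof -
  have "ae_class N (\<lambda>x. h x * f' x) = ae_class N (\<lambda>x. h x * f x)" if "f' \<in> ae_class M f" for f'
  proof (rule ae_class_cong)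
    have "AE x in N. h x \<noteq> 0 \<longrightarrow> f' x = f x"
      using that by (intro transfer) (auto simp: ae_class_def)
    then show "AE x in N. h x * f' x = h x * f x" by eventually_elim auto
  qed
  then show ?thesis
    unfolding mult_op_def using ae_class_self[OF assms(1)] by blast
qed

text \<open>The equation of classes \<open>M\<^sub>g A = [f]\<close> yields a single representative of \<open>A\<close> that
  solves the pointwise equation.\<close>

lemma mult_op_eq_ae_classD:
  assumes A: "A \<in> carrier (Lp p M)" and eq: "mult_op N g A = ae_class N f"
    and f: "f \<in> borel_measurable N"
  obtains u where "u \<in> Lp_functions p M" "A = ae_class M u" "AE x in N. f x = g x * u x"
proof -
  have "f \<in> mult_op N g A" using eq ae_class_self[OF f] by simp
  then obtain u where "u \<in> A" "f \<in> ae_class N (\<lambda>x. g x * u x)"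
    by (auto simp: mult_op_def)
  then show ?thesis
    using that carrier_Lp_representative[OF A] by (auto simp: ae_class_def)
qed

text \<open>Under the same hypothesis on null sets, the operator is computed on representatives, so
  linearity is that of pointwise multiplication and the bound need only be known for functions.\<close>

lemma mult_op_bounded_operator:
  assumes transfer: "\<And>P. AE x in M. P x \<Longrightarrow> AE x in N. h x \<noteq> 0 \<longrightarrow> P x"
    and maps: "\<And>f. f \<in> Lp_functions p M \<Longrightarrow> (\<lambda>x. h x * f x) \<in> Lp_functions q N"
    and bound: "\<And>f. f \<in> Lp_functions p M \<Longrightarrow>
      Lp_seminorm q N (\<lambda>x. h x * f x) \<le> C * Lp_seminorm p M f"
  shows "bounded_operator (Lp p M) (Lp q N) (mult_op N h)"
proof -
  have op: "mult_op N h (ae_class M f) = ae_class N (\<lambda>x. h x * f x)"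
    if "f \<in> borel_measurable M" for f
    by (rule mult_op_ae_class[OF that]) (rule transfer)
  have meas: "(\<lambda>x. h x * f x) \<in> borel_measurable N" if "f \<in> Lp_functions p M" for f
    using Lp_functions_measurable[OF maps[OF that]] .
  have closed: "mult_op N h A \<in> carrier (Lp q N)" if A: "A \<in> carrier (Lp p M)" for A
  proof -
    obtain a where a: "a \<in> Lp_functions p M" "A = ae_class M a"
      using A by (rule carrier_LpE)
    show ?thesis
      unfolding a(2) op[OF Lp_functions_measurable[OF a(1)]] by (intro carrier_LpI maps a(1))
  qed
  have additive: "mult_op N h (add (Lp p M) A B) = add (Lp q N) (mult_op N h A) (mult_op N h B)"
    if A: "A \<in> carrier (Lp p M)" and B: "B \<in> carrier (Lp p M)" for A B
  proof -
    obtain a b where a: "a \<in> Lp_functions p M" "A = ae_class M a"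
      and b: "b \<in> Lp_functions p M" "B = ae_class M b"
      using A B by (blast elim: carrier_LpE)
    show ?thesis
      using Lp_functions_measurable[OF a(1)] Lp_functions_measurable[OF b(1)] meas[OF a(1)] meas[OF b(1)]
      by (simp add: a(2) b(2) op add_Lp_ae_class distrib_left)
  qed
  have homogeneous: "mult_op N h (scale (Lp p M) c A) = scale (Lp q N) c (mult_op N h A)"
    if A: "A \<in> carrier (Lp p M)" for c A
  proof -
    obtain a where a: "a \<in> Lp_functions p M" "A = ae_class M a"
      using A by (rule carrier_LpE)
    show ?thesis
      using Lp_functions_measurable[OF a(1)] meas[OF a(1)]
      by (simp add: a(2) op scale_Lp_ae_class mult.left_commute)
  qed
  have "norm_of (Lp q N) (mult_op N h A) \<le> C * norm_of (Lp p M) A"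
    if A: "A \<in> carrier (Lp p M)" for A
  proof -
    obtain a where a: "a \<in> Lp_functions p M" "A = ae_class M a"
      using A by (rule carrier_LpE)
    show ?thesis
      using bound[OF a(1)] Lp_functions_measurable[OF a(1)]
      by (simp add: a op norm_of_Lp_ae_class maps)
  qed
  with closed additive homogeneous show ?thesis
    unfolding bounded_operator_def by blast
qed

section \<open>Null sets of the two measures\<close>

text \<open>Outside \<open>S\<close> only the part \<open>\<rho> \<cdot> N\<close> of \<open>M\<close> has mass, and it is absolutely continuous with
  respect to \<open>N\<close>.\<close>

lemma lebesgue_decomposition_AE_transfer:
  assumes sets: "sets M = sets N" and dec: "lebesgue_decomposition M N \<rho> M\<^sub>s S"
    and P: "AE x in N. P x"
  shows "AE x in M. x \<notin> S \<longrightarrow> P x"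
proof -
  obtain Z where Z: "{x \<in> space N. \<not> P x} \<subseteq> Z" "Z \<in> null_sets N"
    using P unfolding eventually_ae_filter by blast
  have \<rho>[measurable]: "\<rho> \<in> borel_measurable N" and S: "S \<in> sets M"
    and sets_s: "sets M\<^sub>s = sets M" and null_s: "emeasure M\<^sub>s (space M - S) = 0"
    and split: "\<And>E. E \<in> sets M \<Longrightarrow>
      emeasure M E = emeasure (density N (\<lambda>x. ennreal (\<rho> x))) E + emeasure M\<^sub>s E"
    using dec by (auto simp: lebesgue_decomposition_def)
  define E where "E = Z - S"
  have E: "E \<in> sets M" "E \<in> null_sets N"
    unfolding E_def using Z(2) S sets null_setsD2[OF Z(2)] by (auto intro: null_set_Diff)
  have "AE x in N. x \<in> E \<longrightarrow> ennreal (\<rho> x) = 0"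
    using AE_not_in[OF E(2)] by eventually_elim simp
  then have "E \<in> null_sets (density N (\<lambda>x. ennreal (\<rho> x)))"
    using null_setsD2[OF E(2)] by (simp add: null_sets_density_iff)
  then have "emeasure (density N (\<lambda>x. ennreal (\<rho> x))) E = 0" by auto
  moreover have "emeasure M\<^sub>s E = 0"
  proof -
    have "E \<subseteq> space M - S" using sets.sets_into_space[OF E(1)] by (auto simp: E_def)
    then have "emeasure M\<^sub>s E \<le> emeasure M\<^sub>s (space M - S)"
      using S sets_s by (intro emeasure_mono) auto
    then show ?thesis using null_s by simp
  qed
  ultimately have "E \<in> null_sets M"
    using split[OF E(1)] E(1) by (simp add: null_sets_def)
  moreover have "{x \<in> space M. \<not> (x \<notin> S \<longrightarrow> P x)} \<subseteq> E"
    using Z(1) unfolding E_def sets_eq_imp_space_eq[OF sets] by blast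
  ultimately show ?thesis by (rule AE_I')
qed

text \<open>The class of a function without zeros lies in the range, and every function in this class
  vanishes almost everywhere where \<open>g\<close> does.\<close>

lemma surjective_imp_multiplier_nonzero:
  assumes N: "sigma_finite_measure N" "1 \<le> q"
    and surj: "topologically_surjective (Lp p M) (Lp q N) (mult_op N g)"
  shows "AE x in N. g x \<noteq> 0"
proof -
  obtain y where y: "y \<in> Lp_functions q N" "\<forall>x. y x \<noteq> 0"
    by (rule Lp_nonvanishing_function[OF N])
  obtain A where A: "A \<in> carrier (Lp p M)" "mult_op N g A = ae_class N y"
    using surj carrier_LpI[OF y(1)] unfolding topologically_surjective_def by blast
  obtain u where "AE x in N. y x = g x * u x"
    by (rule mult_op_eq_ae_classD[OF A Lp_functions_measurable[OF y(1)]])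
  then show ?thesis
    by eventually_elim (use y(2) in auto)
qed

text \<open>The indicator of an \<open>M\<close>-null set represents the zero class of \<open>L\<^sub>p(M)\<close>, so its product
  with \<open>g\<close> must vanish \<open>N\<close>-almost everywhere.\<close>

lemma multiplier_nonzero_imp_AE_transfer:
  assumes wd: "mult_well_defined p M q N g" and g: "AE x in N. g x \<noteq> 0"
    and sets: "sets M = sets N" and P: "AE x in M. P x"
  shows "AE x in N. P x"
proof -
  obtain Z where Z: "{x \<in> space M. \<not> P x} \<subseteq> Z" "Z \<in> null_sets M"
    using P unfolding eventually_ae_filter by blast
  have zero: "(\<lambda>x. 0) \<in> Lp_functions p M"
  proof (cases "p = \<infinity>")
    case True
    have "esssup M (\<lambda>x. 0::ennreal) \<le> 0" by (intro esssup_I) auto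
    then show ?thesis using True by (simp add: Lp_functions_def)
  qed (simp add: Lp_functions_def)
  have ae: "AE x in M. indicator Z x = (0::complex)"
    using AE_not_in[OF Z(2)] by eventually_elim simp
  have "(indicator Z :: 'a \<Rightarrow> complex) \<in> borel_measurable M"
    using null_setsD2[OF Z(2)] by (rule borel_measurable_indicator)
  then have ind: "(indicator Z :: 'a \<Rightarrow> complex) \<in> Lp_functions p M"
    by (rule Lp_functions_AE_cong[OF zero _ ae])
  have "AE x in N. g x * indicator Z x = g x * 0"
    using wd[unfolded mult_well_defined_def, THEN conjunct2, rule_format, OF ind zero ae] .
  then show ?thesis using g AE_space
  proof eventually_elim
    case (elim x)
    then have "x \<notin> Z" by (auto simp: indicator_def)
    moreover have "x \<in> space M" using elim(3) sets_eq_imp_space_eq[OF sets] by simp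
    ultimately show ?case using Z(1) by blast
  qed
qed

section \<open>The right inverse\<close>

theorem theorem2p3p4:
  fixes \<mu> \<nu> \<mu>\<^sub>s :: "'a measure"
    and p q :: ennreal
    and g :: "'a \<Rightarrow> complex"
    and \<rho> :: "'a \<Rightarrow> real"
    and \<Omega>\<^sub>c \<Omega>\<^sub>s :: "'a set"
  assumes "sets \<mu> = sets \<nu>"
    and "sigma_finite_measure \<mu>" and "sigma_finite_measure \<nu>"
    and "1 \<le> p" and "1 \<le> q"
    and "g \<in> borel_measurable \<mu>"
    and "mult_well_defined p \<mu> q \<nu> g"
    and "bounded_operator (Lp p \<mu>) (Lp q \<nu>) (mult_op \<nu> g)"
    and "lebesgue_decomposition \<mu> \<nu> \<rho> \<mu>\<^sub>s \<Omega>\<^sub>s"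
    and "\<Omega>\<^sub>c = space \<mu> - \<Omega>\<^sub>s"
  shows "topologically_surjective (Lp p \<mu>) (Lp q \<nu>) (mult_op \<nu> g) \<longleftrightarrow>
    (let h = (\<lambda>x. indicator \<Omega>\<^sub>c x / g x) in
       mult_well_defined q \<nu> p \<mu> h \<and>
       bounded_operator (Lp q \<nu>) (Lp p \<mu>) (mult_op \<mu> h) \<and>
       (\<forall>y\<in>carrier (Lp q \<nu>). mult_op \<nu> g (mult_op \<mu> h y) = y) \<and>
       topologically_injective (Lp q \<nu>) (Lp p \<mu>) (mult_op \<mu> h))"
proof -
  note sets = assms(1) and dec = assms(9)
  define h where "h = (\<lambda>x. indicator \<Omega>\<^sub>c x / g x)"
  define X Y where "X = Lp p \<mu>" and "Y = Lp q \<nu>"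
  have space: "space \<mu> = space \<nu>" using sets by (rule sets_eq_imp_space_eq)
  have borel: "borel_measurable \<mu> = (borel_measurable \<nu> :: ('a \<Rightarrow> complex) set)"
    using sets by (intro measurable_cong_sets) auto
  have \<Omega>\<^sub>s: "\<Omega>\<^sub>s \<in> sets \<mu>" "emeasure \<nu> \<Omega>\<^sub>s = 0"
    using dec by (auto simp: lebesgue_decomposition_def)
  have \<Omega>\<^sub>c[measurable]: "\<Omega>\<^sub>c \<in> sets \<mu>" using \<Omega>\<^sub>s(1) assms(10) by auto
  have g[measurable]: "g \<in> borel_measurable \<mu>" by fact
  have h[measurable]: "h \<in> borel_measurable \<mu>" unfolding h_def by measurable
  have transfer: "AE x in \<mu>. h x \<noteq> 0 \<longrightarrow> P x" if "AE x in \<nu>. P x" for P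
    using lebesgue_decomposition_AE_transfer[OF sets dec that]
    by eventually_elim (auto simp: h_def assms(10) indicator_def)
  have "topologically_surjective X Y (mult_op \<nu> g) \<longleftrightarrow>
      mult_well_defined q \<nu> p \<mu> h \<and> bounded_operator Y X (mult_op \<mu> h) \<and>
      (\<forall>y\<in>carrier Y. mult_op \<nu> g (mult_op \<mu> h y) = y) \<and>
      topologically_injective Y X (mult_op \<mu> h)"
  proof (intro iffI)
    assume surj: "topologically_surjective X Y (mult_op \<nu> g)"
    have g_nz: "AE x in \<nu>. g x \<noteq> 0"
      using surjective_imp_multiplier_nonzero[OF assms(3,5)] surj unfolding X_def Y_def .
    have abs_cont: "AE x in \<nu>. P x" if "AE x in \<mu>. P x" for P
      using multiplier_nonzero_imp_AE_transfer[OF assms(7) g_nz sets that] .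
    obtain c where "c > 0" and c: "\<And>y. y \<in> carrier Y \<Longrightarrow>
        \<exists>x\<in>carrier X. mult_op \<nu> g x = y \<and> norm_of X x \<le> c * norm_of Y y"
      using surj unfolding topologically_surjective_def by blast
    \<comment> \<open>The norm-controlled preimage \<open>u\<close> of \<open>f\<close> dominates \<open>h f\<close>.\<close>
    have key: "(\<lambda>x. h x * f x) \<in> Lp_functions p \<mu> \<and>
        Lp_seminorm p \<mu> (\<lambda>x. h x * f x) \<le> c * Lp_seminorm q \<nu> f"
      if f: "f \<in> Lp_functions q \<nu>" for f
    proof -
      obtain A where A: "A \<in> carrier (Lp p \<mu>)" "mult_op \<nu> g A = ae_class \<nu> f"
        and nA: "norm_of X A \<le> c * norm_of Y (ae_class \<nu> f)"
        using c[of "ae_class \<nu> f"] carrier_LpI[OF f] unfolding X_def Y_def by blast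
      obtain u where u: "u \<in> Lp_functions p \<mu>" "A = ae_class \<mu> u"
        and fu: "AE x in \<nu>. f x = g x * u x"
        by (rule mult_op_eq_ae_classD[OF A Lp_functions_measurable[OF f]])
      \<comment> \<open>Almost everywhere, \<open>h f\<close> is \<open>u\<close> itself where \<open>h \<noteq> 0\<close>, and it is \<open>0\<close> elsewhere.\<close>
      have le: "AE x in \<mu>. cmod (h x * f x) \<le> cmod (u x)"
        using transfer[OF fu]
        by eventually_elim (auto simp: h_def indicator_def norm_mult norm_divide)
      have [measurable]: "f \<in> borel_measurable \<mu>"
        using Lp_functions_measurable[OF f] borel by simp
      have hf: "(\<lambda>x. h x * f x) \<in> borel_measurable \<mu>" by measurable
      have "Lp_seminorm p \<mu> u \<le> c * Lp_seminorm q \<nu> f"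
        using nA u f unfolding X_def Y_def by (simp add: norm_of_Lp_ae_class)
      then show ?thesis
        using Lp_functions_dominated[OF u(1) hf le] Lp_seminorm_mono[OF u(1) hf le] by auto
    qed
    have wd: "mult_well_defined q \<nu> p \<mu> h"
      unfolding mult_well_defined_def
    proof (intro conjI ballI impI)
      fix f f' :: "'a \<Rightarrow> complex" assume "AE x in \<nu>. f x = f' x"
      from transfer[OF this] show "AE x in \<mu>. h x * f x = h x * f' x"
        by eventually_elim auto
    qed (use key in blast)
    have bdd: "bounded_operator Y X (mult_op \<mu> h)"
      unfolding X_def Y_def
    proof (rule mult_op_bounded_operator[where C = c])
      show "AE x in \<mu>. h x \<noteq> 0 \<longrightarrow> P x" if "AE x in \<nu>. P x" for P
        by (rule transfer[OF that])
    qed (simp_all add: key)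
    have inv: "mult_op \<nu> g (mult_op \<mu> h y) = y" if "y \<in> carrier Y" for y
    proof -
      obtain f where f: "f \<in> Lp_functions q \<nu>" "y = ae_class \<nu> f"
        using \<open>y \<in> carrier Y\<close> unfolding Y_def by (rule carrier_LpE)
      have "mult_op \<mu> h y = ae_class \<mu> (\<lambda>x. h x * f x)"
        unfolding f(2) by (rule mult_op_ae_class[OF Lp_functions_measurable[OF f(1)]]) (rule transfer)
      then have "mult_op \<nu> g (mult_op \<mu> h y) = mult_op \<nu> g (ae_class \<mu> (\<lambda>x. h x * f x))"
        by simp
      also have "\<dots> = ae_class \<nu> (\<lambda>x. g x * (h x * f x))"
      proof (rule mult_op_ae_class)
        show "(\<lambda>x. h x * f x) \<in> borel_measurable \<mu>"
          using key[OF f(1)] Lp_functions_measurable by blast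
        show "AE x in \<nu>. g x \<noteq> 0 \<longrightarrow> P x" if "AE x in \<mu>. P x" for P
          using abs_cont[OF that] by eventually_elim simp
      qed
      also have "\<dots> = ae_class \<nu> f"
      proof (rule ae_class_cong)
        have "\<Omega>\<^sub>s \<in> null_sets \<nu>" using \<Omega>\<^sub>s sets by (auto simp: null_sets_def)
        from AE_not_in[OF this] g_nz AE_space
        show "AE x in \<nu>. g x * (h x * f x) = f x"
          by eventually_elim (auto simp: h_def assms(10) space)
      qed
      finally show ?thesis using f(2) by simp
    qed
    have "topologically_injective Y X (mult_op \<mu> h)"
    proof (rule right_inverse_topologically_injective)
      show "bounded_operator X Y (mult_op \<nu> g)" using assms(8) unfolding X_def Y_def .
      show "\<And>y. y \<in> carrier Y \<Longrightarrow> mult_op \<mu> h y \<in> carrier X"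
        using bdd unfolding bounded_operator_def by blast
      show "\<And>x. x \<in> carrier X \<Longrightarrow> 0 \<le> norm_of X x"
        unfolding X_def by (rule norm_of_Lp_nonneg)
    qed (rule inv)
    with wd bdd inv show "mult_well_defined q \<nu> p \<mu> h \<and> bounded_operator Y X (mult_op \<mu> h) \<and>
        (\<forall>y\<in>carrier Y. mult_op \<nu> g (mult_op \<mu> h y) = y) \<and>
        topologically_injective Y X (mult_op \<mu> h)" by blast
  next
    assume rhs: "mult_well_defined q \<nu> p \<mu> h \<and> bounded_operator Y X (mult_op \<mu> h) \<and>
        (\<forall>y\<in>carrier Y. mult_op \<nu> g (mult_op \<mu> h y) = y) \<and>
        topologically_injective Y X (mult_op \<mu> h)"
    show "topologically_surjective X Y (mult_op \<nu> g)"
    proof (rule bounded_right_inverse_topologically_surjective)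
      show "bounded_operator Y X (mult_op \<mu> h)" using rhs by blast
      show "mult_op \<nu> g (mult_op \<mu> h y) = y" if "y \<in> carrier Y" for y using rhs that by blast
      show "\<And>y. y \<in> carrier Y \<Longrightarrow> 0 \<le> norm_of Y y"
        unfolding Y_def by (rule norm_of_Lp_nonneg)
    qed
  qed
  then show ?thesis unfolding X_def Y_def h_def Let_def .
qed

end
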